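(* Let $L>0$ be an integer, let $y>1$ be an odd integer, and let $x$ be an integer with $1<x\le y+2$. Define the integers $a(L,y,n,x)$, $n\ge1$, by \[ \frac{1}{(q,q^{x},q^{2y};q^{2y+2})_L} - \frac{1}{(q^2,q^{y},q^{2y+1};q^{2y+2})_L} = \sum_{n=1}^\infty a(L,y,n,x)\, q^{n}. \] Then $a(L,y,n,x)\ge 0$ for all $n\ge1$. Furthermore, $a(L,y,n,x)=0$ if and only if one of the following holds: (1) $n<x$ and $n$ is even; (2) $n=y$ and $y<x$; (3) $(L,y,n,x)=(1,3,9,5)$.
   Context: For an integer $L\ge 0$, $(a;q)_L=1$ if $L=0$ and $(a;q)_L=\prod_{j=0}^{L-1}(1-aq^j)$ if $L>0$; and $(a_1,\dots,a_k;q)_L=(a_1;q)_L\cdots(a_k;q)_L$. Equivalently, $a(L,y,n,x)=P_1'(L,y,n,x)-P_2(L,y,n)$, where $P_1'(L,y,n,x)$ is the number of partitions of $n$ into parts congruent to $1$, $x$, or $2y \pmod{2y+2}$ with largest part at most $(2y+2)L-2$, and $P_2(L,y,n)$ is the number of partitions of $n$ into parts congruent to $2$, $y$, or $2y+1 \pmod{2y+2}$ with largest part at most $(2y+2)L-1$. *)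

theory Defs
  imports "HOL-Computational_Algebra.Formal_Power_Series"
begin

definition qpoch :: "nat \<Rightarrow> nat \<Rightarrow> nat \<Rightarrow> rat fps" where
  "qpoch c d L = (\<Prod>j<L. 1 - fps_X ^ (c + d * j))"

definition gen_a :: "nat \<Rightarrow> nat \<Rightarrow> nat \<Rightarrow> rat fps" where
  "gen_a L y x =
     inverse (qpoch 1 (2*y+2) L * qpoch x (2*y+2) L * qpoch (2*y) (2*y+2) L)
   - inverse (qpoch 2 (2*y+2) L * qpoch y (2*y+2) L * qpoch (2*y+1) (2*y+2) L)"

definition a_coeff :: "nat \<Rightarrow> nat \<Rightarrow> nat \<Rightarrow> nat \<Rightarrow> rat" where
  "a_coeff L y n x = fps_nth (gen_a L y x) n"

end

theory Submission
  imports Defs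
begin

text \<open>
  Put $h = q^{y+1}$ and $s = q^y$, so that $qs = h$. For $x = y + 2$ the two products are
  $A = (q;h)_{2L}\,(s^2;h^2)_L$ and $B = (s;h)_{2L}\,(q^2;h^2)_L$, which are exchanged by
  $q \leftrightarrow s$. Since $(q^2;h^2)_L = (q;h)_L\,(-q;h)_L$,
  \[ \frac1A - \frac1B = \frac{\varphi(q) - \varphi(s)}{(q^2;h^2)_L\,(s^2;h^2)_L},
     \qquad \varphi(z) = \frac{(-z;h)_L}{(zh^L;h)_L}. \]
  Every factor of $\varphi$ has nonnegative coefficients, and as $y$ is odd, $1 - q^2$ divides
  $q - s = q(1 - q^{y-1})$ with a nonnegative quotient. The identity
  $ff' - gg' = (f - g)f' + g(f' - g')$ carries this over to $\varphi(q) - \varphi(s)$, and the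
  divisor $1 - q^2$ cancels against $(q^2;h^2)_L$. Keeping a few terms of this expansion gives
  strict positivity. Lowering $x$ adds a series that is nonnegative by the same argument
  with $1 - q$ in place of $1 - q^2$.
\<close>

subsection \<open>Coefficientwise order\<close>

definition fps_le :: "'a::linordered_field fps \<Rightarrow> 'a fps \<Rightarrow> bool" (infix "\<preceq>" 50) where
  "f \<preceq> g \<longleftrightarrow> (\<forall>n. fps_nth f n \<le> fps_nth g n)"

lemma fps_le_refl [simp]: "f \<preceq> f"
  by (simp add: fps_le_def)

lemma fps_le_trans [trans]: "f \<preceq> g \<Longrightarrow> g \<preceq> h \<Longrightarrow> f \<preceq> h"
  by (auto simp: fps_le_def intro: order_trans)

lemma fps_nonneg_add: "0 \<preceq> f \<Longrightarrow> 0 \<preceq> g \<Longrightarrow> 0 \<preceq> f + g"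
  by (simp add: fps_le_def)

lemma fps_le_add_right: "0 \<preceq> g \<Longrightarrow> f \<preceq> f + g"
  by (simp add: fps_le_def)

lemma fps_nonneg_mult: "0 \<preceq> f \<Longrightarrow> 0 \<preceq> g \<Longrightarrow> 0 \<preceq> f * g"
  by (auto simp: fps_le_def fps_mult_nth intro!: sum_nonneg)

lemma fps_le_mult:
  assumes "f \<preceq> g" "f' \<preceq> g'" "0 \<preceq> f" "0 \<preceq> f'"
  shows "f * f' \<preceq> g * g'"
proof -
  have "0 \<preceq> g"
    using assms fps_le_trans by blast
  then show ?thesis
    using assms unfolding fps_le_def fps_mult_nth by (auto intro!: sum_mono mult_mono)
qed

lemma fps_nonneg_one [simp]: "0 \<preceq> (1 :: 'a::linordered_field fps)"
  by (simp add: fps_le_def)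

lemma fps_nonneg_X_power [simp]: "0 \<preceq> (fps_X ^ k :: 'a::linordered_field fps)"
  by (simp add: fps_le_def fps_X_power_nth)

lemma fps_one_le_imp_nonneg: "1 \<preceq> f \<Longrightarrow> 0 \<preceq> f"
  using fps_le_trans fps_nonneg_one by blast

lemma fps_one_le_mult: "1 \<preceq> f \<Longrightarrow> 1 \<preceq> g \<Longrightarrow> 1 \<preceq> f * g"
  using fps_le_mult[of 1 f 1 g] fps_one_le_imp_nonneg by auto

lemma fps_one_le_prod: "(\<And>i. i \<in> I \<Longrightarrow> 1 \<preceq> f i) \<Longrightarrow> 1 \<preceq> (\<Prod>i\<in>I. f i)"
  by (induction I rule: infinite_finite_induct) (auto intro: fps_one_le_mult)

lemma fps_nonneg_sum: "(\<And>i. i \<in> I \<Longrightarrow> 0 \<preceq> f i) \<Longrightarrow> 0 \<preceq> (\<Sum>i\<in>I. f i)"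
  by (induction I rule: infinite_finite_induct) (auto intro: fps_nonneg_add)

lemma fps_le_mult_left: "0 \<preceq> f \<Longrightarrow> 1 \<preceq> g \<Longrightarrow> f \<preceq> f * g"
  using fps_le_mult[of f f 1 g] by simp

text \<open>The convolution contains the product of these two coefficients, and none of its other
  summands is negative.\<close>

lemma fps_nth_mult_pos:
  assumes "0 \<preceq> f" "0 \<preceq> g" "0 < fps_nth f a" "0 < fps_nth g b"
  shows "0 < fps_nth (f * g) (a + b)"
proof -
  have "0 < fps_nth f a * fps_nth g (a + b - a)"
    using assms by simp
  also have "\<dots> \<le> (\<Sum>i=0..a+b. fps_nth f i * fps_nth g (a + b - i))"
    using assms(1,2) unfolding fps_le_def
    by (intro member_le_sum[where f="\<lambda>i. fps_nth f i * fps_nth g (a + b - i)"]) auto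
  finally show ?thesis
    by (simp add: fps_mult_nth)
qed

lemma fps_nth_pos_mono: "f \<preceq> g \<Longrightarrow> 0 < fps_nth f n \<Longrightarrow> 0 < fps_nth g n"
  unfolding fps_le_def by (meson less_le_trans)

section \<open>Geometric series\<close>

lemma inverse_one_minus_X_power:
  assumes "k > 0"
  shows "inverse (1 - fps_X ^ k) = Abs_fps (\<lambda>n. if k dvd n then 1 else (0 :: 'a::linordered_field))"
proof (rule fps_inverse_unique)
  show "(1 - fps_X ^ k) * Abs_fps (\<lambda>n. if k dvd n then 1 else (0 :: 'a)) = 1"
  proof (rule fps_ext)
    fix n
    show "fps_nth ((1 - fps_X ^ k) * Abs_fps (\<lambda>n. if k dvd n then 1 else (0 :: 'a))) n = fps_nth 1 n"
      using assms
      by (auto simp: left_diff_distrib fps_X_power_mult_nth dvd_minus_self dest: dvd_imp_le)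
  qed
qed

lemma inverse_one_minus_X_power_nth:
  "k > 0 \<Longrightarrow> fps_nth (inverse (1 - fps_X ^ k)) n = (if k dvd n then 1 else (0 :: 'a::linordered_field))"
  by (simp add: inverse_one_minus_X_power)

lemma one_plus_X_power_le_inverse:
  "k > 0 \<Longrightarrow> 1 + fps_X ^ k \<preceq> inverse (1 - fps_X ^ k :: 'a::linordered_field fps)"
  by (auto simp: fps_le_def inverse_one_minus_X_power_nth fps_X_power_nth)

lemma one_le_one_plus_X_power: "1 \<preceq> (1 + fps_X ^ k :: 'a::linordered_field fps)"
  by (simp add: fps_le_add_right)

lemma one_le_inverse_one_minus_X_power:
  "k > 0 \<Longrightarrow> 1 \<preceq> inverse (1 - fps_X ^ k :: 'a::linordered_field fps)"
  using fps_le_trans one_le_one_plus_X_power one_plus_X_power_le_inverse by blast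

lemma X_power_le_inverse:
  "k > 0 \<Longrightarrow> fps_X ^ (k * i) \<preceq> inverse (1 - fps_X ^ k :: 'a::linordered_field fps)"
  by (auto simp: fps_le_def inverse_one_minus_X_power_nth fps_X_power_nth)

lemma one_minus_X_power_inverse:
  assumes "k > 0"
  shows "(1 - fps_X ^ k) * inverse (1 - fps_X ^ k) = (1 :: 'a::linordered_field fps)"
  using inverse_mult_eq_1[of "1 - fps_X ^ k :: 'a fps"] assms
  by (simp add: mult.commute)

lemma one_le_inverse_prod:
  assumes "\<And>i. i \<in> I \<Longrightarrow> 0 < k i"
  shows "1 \<preceq> inverse (\<Prod>i\<in>I. 1 - fps_X ^ k i :: 'a::linordered_field fps)"
  unfolding inverse_prod_fps using assms
  by (intro fps_one_le_prod one_le_inverse_one_minus_X_power)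

subsection \<open>Differences of products divisible by a fixed series\<close>

text \<open>The quotient \<open>r\<close> is an explicit argument because later arguments need lower
  bounds for it. The conditions that \<open>f\<close> and \<open>g\<close> dominate 1 keep products
  nonnegative and allow cofactors to be dropped from lower bounds.\<close>

definition fps_gap :: "'a::linordered_field fps \<Rightarrow> 'a fps \<Rightarrow> 'a fps \<Rightarrow> 'a fps \<Rightarrow> bool" where
  "fps_gap d f g r \<longleftrightarrow> 1 \<preceq> f \<and> 1 \<preceq> g \<and> 0 \<preceq> r \<and> f - g = d * r"

text \<open>The resulting quotient is asymmetric: the first gap is weighted by \<open>f'\<close>,
  the second by \<open>g\<close>. The order of the factors therefore decides which cofactor
  accompanies which gap.\<close>

lemma fps_gap_mult:
  assumes "fps_gap d f g r" "fps_gap d f' g' r'"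
  shows "fps_gap d (f * f') (g * g') (r * f' + g * r')"
proof -
  have "f * f' - g * g' = (f - g) * f' + g * (f' - g')"
    by (simp add: algebra_simps)
  also have "\<dots> = d * (r * f' + g * r')"
    using assms by (simp add: fps_gap_def algebra_simps)
  finally show ?thesis
    using assms unfolding fps_gap_def
    by (auto intro!: fps_one_le_mult fps_nonneg_add fps_nonneg_mult dest: fps_one_le_imp_nonneg)
qed

lemma fps_gap_prod:
  assumes "\<And>i. i \<in> I \<Longrightarrow> fps_gap d (f i) (g i) (r i)"
  shows "\<exists>R. fps_gap d (\<Prod>i\<in>I. f i) (\<Prod>i\<in>I. g i) R"
  using assms
proof (induction I rule: infinite_finite_induct)
  case (insert i I)
  then show ?case
    using fps_gap_mult[of d "f i" "g i" "r i"] by fastforce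
qed (auto simp: fps_gap_def intro!: exI[of _ 0])

text \<open>With u and v the two powers, 1/(1 - u) - 1/(1 - v) = (u - v)/((1 - u)(1 - v)).\<close>

lemma fps_gap_inverse:
  fixes r :: "'a::linordered_field fps"
  assumes "a > 0" "b > 0" "0 \<preceq> r" "fps_X ^ a - fps_X ^ b = d * r"
  shows "fps_gap d (inverse (1 - fps_X ^ a)) (inverse (1 - fps_X ^ b))
           (r * (inverse (1 - fps_X ^ a) * inverse (1 - fps_X ^ b)))"
proof -
  let ?A = "1 - fps_X ^ a :: 'a fps" and ?B = "1 - fps_X ^ b :: 'a fps"
  have A: "?A * inverse ?A = 1" and B: "?B * inverse ?B = 1"
    using one_minus_X_power_inverse assms by auto
  have "inverse ?A - inverse ?B = (?B * inverse ?B) * inverse ?A - (?A * inverse ?A) * inverse ?B"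
    unfolding A B by simp
  also have "\<dots> = (fps_X ^ a - fps_X ^ b) * (inverse ?A * inverse ?B)"
    by (simp add: algebra_simps)
  finally have "inverse ?A - inverse ?B = d * (r * (inverse ?A * inverse ?B))"
    by (simp add: assms(4) mult.assoc)
  then show ?thesis
    using assms unfolding fps_gap_def
    by (auto intro!: fps_nonneg_mult one_le_inverse_one_minus_X_power
        fps_one_le_imp_nonneg[OF one_le_inverse_one_minus_X_power])
qed

subsection \<open>The case x = y + 2\<close>

text \<open>This is (1 - q^(2k))/(1 - q^2). For y = 2k + 1 it is the nonnegative quotient in q - q^y
  = q (1 - q^2) \<open>even_powers k\<close>.\<close>

definition even_powers :: "nat \<Rightarrow> rat fps" where
  "even_powers k = (\<Sum>i<k. fps_X ^ (2 * i))"

lemma even_powers_nonneg: "0 \<preceq> even_powers k"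
  unfolding even_powers_def by (intro fps_nonneg_sum) simp

lemma even_powers_nth_pos: "i < k \<Longrightarrow> 0 < fps_nth (even_powers k) (2 * i)"
  unfolding even_powers_def by (simp add: fps_sum_nth sum.delta)

lemma even_powers_telescope: "(1 - fps_X ^ 2) * even_powers k = 1 - fps_X ^ (2 * k)"
  using one_diff_power_eq[of "fps_X ^ 2 :: rat fps" k]
  by (simp add: even_powers_def flip: power_mult)

text \<open>The factors of $\varphi(q^c)$ for $h = q^e$.\<close>

definition race_factor :: "nat \<Rightarrow> nat \<Rightarrow> nat \<Rightarrow> nat \<Rightarrow> rat fps" where
  "race_factor e L c j =
     (if j < L then 1 + fps_X ^ (c + e * j) else inverse (1 - fps_X ^ (c + e * j)))"

lemma one_plus_X_power_le_race_factor:
  "c > 0 \<Longrightarrow> 1 + fps_X ^ (c + e * j) \<preceq> race_factor e L c j"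
  by (simp add: race_factor_def one_plus_X_power_le_inverse)

text \<open>The quotient is q^(1 + ej) \<open>even_powers k\<close>, multiplied by two geometric
  series when the factor is an inverse. The lower bound suffices for L \<ge> 2; the exact form for L
  \<le> j serves L = 1, where powers are drawn from such a series.\<close>

lemma race_factor_gap:
  obtains r where
    "fps_gap (1 - fps_X ^ 2) (race_factor e L 1 j) (race_factor e L (2 * k + 1) j) r"
    "fps_X ^ (1 + e * j) * even_powers k \<preceq> r"
    "L \<le> j \<Longrightarrow> r = fps_X ^ (1 + e * j) * even_powers k *
       (inverse (1 - fps_X ^ (1 + e * j)) * inverse (1 - fps_X ^ (2 * k + 1 + e * j)))"
proof -
  let ?r = "fps_X ^ (1 + e * j) * even_powers k"
  have r: "0 \<preceq> ?r"
    by (intro fps_nonneg_mult even_powers_nonneg fps_nonneg_X_power)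
  have "fps_X ^ (1 + e * j) - fps_X ^ (2 * k + 1 + e * j)
      = (fps_X ^ (1 + e * j) * (1 - fps_X ^ (2 * k)) :: rat fps)"
    by (simp add: algebra_simps power_add)
  then have diff: "fps_X ^ (1 + e * j) - fps_X ^ (2 * k + 1 + e * j) = (1 - fps_X ^ 2) * ?r"
    by (simp add: mult.left_commute flip: even_powers_telescope)
  show ?thesis
  proof (cases "j < L")
    case True
    then have "fps_gap (1 - fps_X ^ 2) (race_factor e L 1 j) (race_factor e L (2 * k + 1) j) ?r"
      using r diff one_le_one_plus_X_power[of "1 + e * j", where 'a = rat]
        one_le_one_plus_X_power[of "2 * k + 1 + e * j", where 'a = rat]
      by (simp add: fps_gap_def race_factor_def)
    with True show ?thesis
      by (intro that) auto
  next
    case False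
    let ?i = "inverse (1 - fps_X ^ (1 + e * j)) * inverse (1 - fps_X ^ (2 * k + 1 + e * j)) :: rat fps"
    have "fps_gap (1 - fps_X ^ 2) (race_factor e L 1 j) (race_factor e L (2 * k + 1) j) (?r * ?i)"
      using False fps_gap_inverse[OF _ _ r diff] by (simp add: race_factor_def)
    moreover have "?r \<preceq> ?r * ?i"
      using r by (intro fps_le_mult_left fps_one_le_mult one_le_inverse_one_minus_X_power) auto
    ultimately show ?thesis
      by (intro that) auto
  qed
qed

section \<open>Factorization of the q-products\<close>

lemma qpoch_nth_0: "c > 0 \<Longrightarrow> fps_nth (qpoch c d L) 0 = 1"
  unfolding qpoch_def by (induction L) auto

lemma qpoch_head:
  assumes "L > 0"
  shows "qpoch c d L = (1 - fps_X ^ c) * (\<Prod>j\<in>{1..<L}. 1 - fps_X ^ (c + d * j))"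
  using assms unfolding qpoch_def by (simp add: lessThan_atLeast0 prod.atLeast_Suc_lessThan)

text \<open>The even and the odd indices of the product on the right give the two products on the
  left.\<close>

lemma qpoch_interleave: "qpoch c (2 * e) L * qpoch (c + e) (2 * e) L = qpoch c e (2 * L)"
  unfolding qpoch_def by (induction L) (auto simp: algebra_simps)

text \<open>Below L, (1 - u)(1 + u) = 1 - u^2 yields the factors on the right; from L on, each
  factor meets its own inverse.\<close>

lemma qpoch_mult_race_factors:
  assumes "c > 0"
  shows "qpoch c e (2 * L) * (\<Prod>j<2*L. race_factor e L c j) = qpoch (2 * c) (2 * e) L"
proof -
  let ?t = "\<lambda>j. (1 - fps_X ^ (c + e * j)) * race_factor e L c j"
  have "qpoch c e (2 * L) * (\<Prod>j<2*L. race_factor e L c j) = (\<Prod>j<2*L. ?t j)"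
    by (simp add: qpoch_def prod.distrib)
  also have "\<dots> = (\<Prod>j<L. ?t j) * (\<Prod>j\<in>{L..<2*L}. ?t j)"
    by (subst prod.union_disjoint[symmetric]) (auto intro!: prod.cong)
  also have "(\<Prod>j\<in>{L..<2*L}. ?t j) = 1"
    using assms by (intro prod.neutral) (auto simp: race_factor_def one_minus_X_power_inverse)
  also have "(\<Prod>j<L. ?t j) = qpoch (2 * c) (2 * e) L"
    unfolding qpoch_def
    by (intro prod.cong) (auto simp: race_factor_def algebra_simps power_add mult_2_right)
  finally show ?thesis
    by simp
qed

lemma inverse_qpoch_interleaved:
  assumes "c > 0"
  shows "inverse (qpoch c e (2 * L)) =
           inverse (qpoch (2 * c) (2 * e) L) * (\<Prod>j<2*L. race_factor e L c j)"
proof -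
  let ?P = "qpoch c e (2 * L)" and ?Q = "qpoch (2 * c) (2 * e) L"
  let ?F = "\<Prod>j<2*L. race_factor e L c j"
  have P: "inverse ?P * ?P = 1" and Q: "inverse ?Q * ?Q = 1"
    using assms by (auto intro!: inverse_mult_eq_1 simp: qpoch_nth_0)
  have "inverse ?P = inverse ?P * (inverse ?Q * ?Q)"
    unfolding Q by simp
  also have "\<dots> = inverse ?P * (inverse ?Q * (?P * ?F))"
    by (simp only: qpoch_mult_race_factors[OF assms])
  also have "\<dots> = (inverse ?P * ?P) * (inverse ?Q * ?F)"
    by (simp only: mult_ac)
  finally show ?thesis
    unfolding P by simp
qed

text \<open>The divisor 1 - q^2 of the gap cancels the first factor of one denominator. The factor
  1/(1 - q^(2y)) stays visible because it makes positivity periodic with period 2y; all remaining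
  factors go into \<open>E\<close>.\<close>

lemma gen_a_eq_gap:
  assumes "L > 0" "y = 2 * k + 1"
    and gap: "fps_gap (1 - fps_X ^ 2) (\<Prod>j<2*L. race_factor (y + 1) L 1 j)
                (\<Prod>j<2*L. race_factor (y + 1) L y j) R"
  obtains E where "1 \<preceq> E" "gen_a L y (y + 2) = R * inverse (1 - fps_X ^ (2 * y)) * E"
proof -
  let ?f = "\<Prod>j<2*L. race_factor (y + 1) L 1 j" and ?g = "\<Prod>j<2*L. race_factor (y + 1) L y j"
  let ?m = "2 * y + 2"
  let ?T2 = "\<Prod>j\<in>{1..<L}. 1 - fps_X ^ (2 + ?m * j) :: rat fps"
  let ?Ty = "\<Prod>j\<in>{1..<L}. 1 - fps_X ^ (2 * y + ?m * j) :: rat fps"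
  \<comment> \<open>The choice x = y + 2 enters here: 1 and y + 2 differ by half the modulus, and so
    do y and 2y + 1.\<close>
  have A: "qpoch 1 ?m L * qpoch (y + 2) ?m L = qpoch 1 (y + 1) (2 * L)"
    using qpoch_interleave[of 1 "y + 1" L] by simp
  have B: "qpoch y ?m L * qpoch (2 * y + 1) ?m L = qpoch y (y + 1) (2 * L)"
    using qpoch_interleave[of y "y + 1" L] by (simp add: mult_2)
  have iA: "inverse (qpoch 1 (y + 1) (2 * L)) = inverse (qpoch 2 ?m L) * ?f"
    using inverse_qpoch_interleaved[of 1 "y + 1" L] by simp
  have iB: "inverse (qpoch y (y + 1) (2 * L)) = inverse (qpoch (2 * y) ?m L) * ?g"
    using inverse_qpoch_interleaved[of y "y + 1" L] assms(2) by simp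
  have "gen_a L y (y + 2) = inverse (qpoch 1 (y + 1) (2 * L)) * inverse (qpoch (2 * y) ?m L)
      - inverse (qpoch 2 ?m L) * inverse (qpoch y (y + 1) (2 * L))"
    unfolding gen_a_def A[symmetric] B[symmetric] by (simp add: fps_inverse_mult mult_ac)
  also have "\<dots> = inverse (qpoch 2 ?m L) * inverse (qpoch (2 * y) ?m L) * (?f - ?g)"
    unfolding iA iB by (simp add: algebra_simps)
  also have "?f - ?g = (1 - fps_X ^ 2) * R"
    using gap by (simp add: fps_gap_def)
  also have "inverse (qpoch 2 ?m L) = inverse (1 - fps_X ^ 2) * inverse ?T2"
    using assms(1) by (simp only: qpoch_head fps_inverse_mult)
  also have "inverse (qpoch (2 * y) ?m L) = inverse (1 - fps_X ^ (2 * y)) * inverse ?Ty"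
    using assms(1) by (simp only: qpoch_head fps_inverse_mult)
  finally have "gen_a L y (y + 2) = ((1 - fps_X ^ 2) * inverse (1 - fps_X ^ 2)) *
      (R * inverse (1 - fps_X ^ (2 * y)) * (inverse ?T2 * inverse ?Ty))"
    by (simp add: mult_ac)
  then have "gen_a L y (y + 2) = R * inverse (1 - fps_X ^ (2 * y)) * (inverse ?T2 * inverse ?Ty)"
    by (simp only: one_minus_X_power_inverse zero_less_numeral mult_1)
  moreover have "1 \<preceq> inverse ?T2 * inverse ?Ty"
    using assms(2) by (intro fps_one_le_mult one_le_inverse_prod) auto
  ultimately show ?thesis
    using that by blast
qed

text \<open>Reduces positivity to arithmetic: n has to be a multiple of 2y, plus an odd number from
  1 to y - 2 (supplied by q \<open>even_powers k\<close>), plus a shift \<open>s\<close> available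
  in \<open>R\<close>.\<close>

lemma gen_a_nth_pos:
  assumes L: "L > 0" and y: "y = 2 * k + 1" "k > 0"
    and gap: "fps_gap (1 - fps_X ^ 2) (\<Prod>j<2*L. race_factor (y + 1) L 1 j)
                (\<Prod>j<2*L. race_factor (y + 1) L y j) R"
    and s: "fps_X ^ (1 + s) * even_powers k \<preceq> R" and "i < k"
  shows "0 < fps_nth (gen_a L y (y + 2)) (2 * y * l + (1 + 2 * i) + s)"
proof -
  obtain E where E: "1 \<preceq> E" "gen_a L y (y + 2) = R * inverse (1 - fps_X ^ (2 * y)) * E"
    using gen_a_eq_gap[OF L y(1) gap] .
  have y0: "0 < 2 * y"
    using y by simp
  have R: "0 \<preceq> R"
    using gap by (simp add: fps_gap_def)
  have inv: "0 \<preceq> (inverse (1 - fps_X ^ (2 * y)) :: rat fps)"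
    using y by (intro fps_one_le_imp_nonneg one_le_inverse_one_minus_X_power) auto
  have "0 < fps_nth (fps_X ^ (1 + s) * even_powers k) (1 + s + 2 * i)"
    using \<open>i < k\<close> by (intro fps_nth_mult_pos even_powers_nth_pos even_powers_nonneg fps_nonneg_X_power) auto
  then have "0 < fps_nth R (1 + s + 2 * i)"
    using s fps_nth_pos_mono by blast
  moreover have "0 < fps_nth (inverse (1 - fps_X ^ (2 * y)) :: rat fps) (2 * y * l)"
    using y0 by (simp add: inverse_one_minus_X_power_nth)
  ultimately have "0 < fps_nth (R * inverse (1 - fps_X ^ (2 * y))) (1 + s + 2 * i + 2 * y * l)"
    by (intro fps_nth_mult_pos R inv)
  moreover have "R * inverse (1 - fps_X ^ (2 * y)) \<preceq> gen_a L y (y + 2)"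
    unfolding E(2) using E(1) R inv by (intro fps_le_mult_left fps_nonneg_mult)
  ultimately have "0 < fps_nth (gen_a L y (y + 2)) (1 + s + 2 * i + 2 * y * l)"
    using fps_nth_pos_mono by blast
  then show ?thesis
    by (simp add: add_ac)
qed

section \<open>Available shifts\<close>

lemma X_power_le_race_factor:
  assumes "c > 0"
  shows "fps_X ^ (c + e * j) \<preceq> race_factor e L c j" "1 \<preceq> race_factor e L c j"
proof -
  have "fps_X ^ (c + e * j) \<preceq> fps_X ^ (c + e * j) + (1 :: rat fps)"
    by (intro fps_le_add_right) simp
  also have "\<dots> \<preceq> race_factor e L c j"
    using one_plus_X_power_le_race_factor[OF assms] by (simp add: add.commute)
  finally show "fps_X ^ (c + e * j) \<preceq> race_factor e L c j" .
  show "1 \<preceq> race_factor e L c j"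
    using one_plus_X_power_le_race_factor[OF assms] one_le_one_plus_X_power fps_le_trans by blast
qed

text \<open>For L \<ge> 2 the indices 0, 1, 2 all occur. Expanding the product gap over them gives
  one summand per index, and a shift arises from the gap of one index times a power of q from its
  cofactor.\<close>

lemma gap_shifts:
  assumes L: "L \<ge> 2" and y: "y = 2 * k + 1"
  obtains R where "fps_gap (1 - fps_X ^ 2) (\<Prod>j<2*L. race_factor (y + 1) L 1 j)
                     (\<Prod>j<2*L. race_factor (y + 1) L y j) R"
    "\<And>s. s \<in> {0, y + 1, y + 2, 2 * y + 1, 2 * y + 2, 2 * y + 3} \<Longrightarrow>
        fps_X ^ (1 + s) * even_powers k \<preceq> R"
proof -
  let ?f = "race_factor (y + 1) L 1" and ?g = "race_factor (y + 1) L y"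
  have "\<forall>j. \<exists>r. fps_gap (1 - fps_X ^ 2) (?f j) (?g j) r \<and>
          fps_X ^ (1 + (y + 1) * j) * even_powers k \<preceq> r"
    unfolding y using race_factor_gap by metis
  then obtain r where r: "\<And>j. fps_gap (1 - fps_X ^ 2) (?f j) (?g j) (r j)"
      "\<And>j. fps_X ^ (1 + (y + 1) * j) * even_powers k \<preceq> r j"
    by metis
  obtain R' where R': "fps_gap (1 - fps_X ^ 2) (\<Prod>j\<in>{3..<2*L}. ?f j) (\<Prod>j\<in>{3..<2*L}. ?g j) R'"
    using fps_gap_prod[of "{3..<2*L}"] r(1) by blast
  let ?F = "\<Prod>j\<in>{3..<2*L}. ?f j"
  \<comment> \<open>The factor with index 2 is split off first: only then does its gap occur with
    the cofactor \<open>?f 0\<close> instead of \<open>?g 0\<close>, which the shift \<open>2 * y + 3\<close> needs.\<close>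
  let ?R = "r 2 * (?f 0 * (?f 1 * ?F)) + ?g 2 * (r 0 * (?f 1 * ?F) + ?g 0 * (r 1 * ?F + ?g 1 * R'))"
  have split: "(\<Prod>j<2*L. h j) = h 2 * (h 0 * (h 1 * (\<Prod>j\<in>{3..<2*L}. h j)))"
    for h :: "nat \<Rightarrow> rat fps"
  proof -
    have "{..<2*L} = insert 2 (insert 0 (insert 1 {3..<2*L}))"
      using L by auto
    then show ?thesis
      by simp
  qed
  have "fps_gap (1 - fps_X ^ 2) (\<Prod>j<2*L. ?f j) (\<Prod>j<2*L. ?g j) ?R"
    unfolding split by (intro fps_gap_mult r(1) R')
  moreover have "fps_X ^ (1 + s) * even_powers k \<preceq> ?R"
    if "s \<in> {0, y + 1, y + 2, 2 * y + 1, 2 * y + 2, 2 * y + 3}" for s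
  proof -
    have f: "\<And>j. 1 \<preceq> ?f j" "\<And>j. fps_X ^ (1 + (y + 1) * j) \<preceq> ?f j" and F: "1 \<preceq> ?F"
      using X_power_le_race_factor(1)[of 1 "y + 1" _ L] X_power_le_race_factor(2)[of 1]
      by (auto intro!: fps_one_le_prod)
    have g: "\<And>j. 1 \<preceq> ?g j" "\<And>j. fps_X ^ (y + (y + 1) * j) \<preceq> ?g j"
      using X_power_le_race_factor(1)[of y "y + 1" _ L] X_power_le_race_factor(2)[of y] y
      by auto
    have nn: "\<And>j. 0 \<preceq> ?f j" "\<And>j. 0 \<preceq> ?g j" "\<And>j. 0 \<preceq> r j" "0 \<preceq> ?F" "0 \<preceq> R'"
      using r(1) R' f g F fps_one_le_imp_nonneg by (auto simp: fps_gap_def)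
    \<comment> \<open>A power q^a below the cofactor \<open>h\<close> moves the lower bound for gap
      \<open>j\<close> up by \<open>a\<close>.\<close>
    have bound: "fps_X ^ (a + (1 + (y + 1) * j)) * even_powers k \<preceq> r j * h"
      if "fps_X ^ a \<preceq> h" for a j h
    proof -
      have "fps_X ^ (1 + (y + 1) * j) * even_powers k * fps_X ^ a \<preceq> r j * h"
        using that r(2)[of j]
        by (intro fps_le_mult fps_nonneg_mult even_powers_nonneg fps_nonneg_X_power)
      then show ?thesis
        by (simp only: power_add mult_ac)
    qed
    \<comment> \<open>Each of \<open>R0\<close>, \<open>R1\<close> and \<open>R2\<close> keeps the
      summand of \<open>?R\<close> for one index and drops nonnegative terms; \<open>R1\<close> also
      reduces its cofactor to \<open>?g 0\<close>.\<close>
    have R0: "r 0 * (?f 1 * ?F) \<preceq> ?R"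
    proof -
      have "r 0 * (?f 1 * ?F) \<preceq> r 0 * (?f 1 * ?F) + ?g 0 * (r 1 * ?F + ?g 1 * R')"
        by (intro fps_le_add_right fps_nonneg_mult fps_nonneg_add nn)
      also have "\<dots> \<preceq> (r 0 * (?f 1 * ?F) + ?g 0 * (r 1 * ?F + ?g 1 * R')) * ?g 2"
        by (intro fps_le_mult_left fps_nonneg_mult fps_nonneg_add nn g)
      also have "\<dots> \<preceq> (r 0 * (?f 1 * ?F) + ?g 0 * (r 1 * ?F + ?g 1 * R')) * ?g 2
          + r 2 * (?f 0 * (?f 1 * ?F))"
        by (intro fps_le_add_right fps_nonneg_mult nn)
      finally show ?thesis
        by (simp only: add.commute mult.commute)
    qed
    have R1: "r 1 * ?g 0 \<preceq> ?R"
    proof -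
      have "r 1 * ?g 0 \<preceq> r 1 * ?g 0 * ?F"
        by (intro fps_le_mult_left fps_nonneg_mult nn F)
      also have "\<dots> \<preceq> r 1 * ?g 0 * ?F + (?g 0 * (?g 1 * R') + r 0 * (?f 1 * ?F))"
        by (intro fps_le_add_right fps_nonneg_mult fps_nonneg_add nn)
      also have "\<dots> = r 0 * (?f 1 * ?F) + ?g 0 * (r 1 * ?F + ?g 1 * R')"
        by (simp add: algebra_simps)
      also have "\<dots> \<preceq> (r 0 * (?f 1 * ?F) + ?g 0 * (r 1 * ?F + ?g 1 * R')) * ?g 2"
        by (intro fps_le_mult_left fps_nonneg_mult fps_nonneg_add nn g)
      also have "\<dots> \<preceq> (r 0 * (?f 1 * ?F) + ?g 0 * (r 1 * ?F + ?g 1 * R')) * ?g 2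
          + r 2 * (?f 0 * (?f 1 * ?F))"
        by (intro fps_le_add_right fps_nonneg_mult nn)
      finally show ?thesis
        by (simp only: add.commute mult.commute)
    qed
    have R2: "r 2 * (?f 0 * (?f 1 * ?F)) \<preceq> ?R"
      by (intro fps_le_add_right fps_nonneg_mult fps_nonneg_add nn)
    have f1: "fps_X ^ (y + 2) \<preceq> ?f 1 * ?F"
    proof -
      have "fps_X ^ (y + 2) \<preceq> ?f 1"
        using f(2)[of 1] by simp
      also have "\<dots> \<preceq> ?f 1 * ?F"
        by (intro fps_le_mult_left nn F)
      finally show ?thesis .
    qed
    have f0: "fps_X ^ 1 \<preceq> ?f 0 * (?f 1 * ?F)"
    proof -
      have "fps_X ^ 1 \<preceq> ?f 0"
        using f(2)[of 0] by simp
      also have "\<dots> \<preceq> ?f 0 * (?f 1 * ?F)"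
        by (intro fps_le_mult_left fps_one_le_mult f F nn)
      finally show ?thesis .
    qed
    have one: "fps_X ^ 0 \<preceq> ?f 1 * ?F" "fps_X ^ 0 \<preceq> ?g 0" "fps_X ^ 0 \<preceq> ?f 0 * (?f 1 * ?F)"
      using f g F by (auto intro!: fps_one_le_mult)
    have g0: "fps_X ^ y \<preceq> ?g 0"
      using g(2)[of 0] by simp
    \<comment> \<open>Each exponent 1 + s is a + (1 + (y + 1) j): \<open>j\<close> is the index of
      the gap used and q^a the power taken from its cofactor.\<close>
    have eq: "1 + (0::nat) = 0 + (1 + (y + 1) * 0)" "1 + (y + 2) = (y + 2) + (1 + (y + 1) * 0)"
      "1 + (y + 1) = 0 + (1 + (y + 1) * 1)" "1 + (2 * y + 1) = y + (1 + (y + 1) * 1)"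
      "1 + (2 * y + 2) = 0 + (1 + (y + 1) * 2)" "1 + (2 * y + 3) = 1 + (1 + (y + 1) * 2)"
      by simp_all
    from that consider "s = 0" | "s = y + 1" | "s = y + 2" | "s = 2 * y + 1" | "s = 2 * y + 2"
      | "s = 2 * y + 3"
      by auto
    then show ?thesis
    proof cases
      case 1
      show ?thesis unfolding 1 eq(1) by (rule fps_le_trans[OF bound[OF one(1)] R0])
    next
      case 2
      show ?thesis unfolding 2 eq(3) by (rule fps_le_trans[OF bound[OF one(2)] R1])
    next
      case 3
      show ?thesis unfolding 3 eq(2) by (rule fps_le_trans[OF bound[OF f1] R0])
    next
      case 4
      show ?thesis unfolding 4 eq(4) by (rule fps_le_trans[OF bound[OF g0] R1])
    next
      case 5
      show ?thesis unfolding 5 eq(5) by (rule fps_le_trans[OF bound[OF one(3)] R2])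
    next
      case 6
      show ?thesis unfolding 6 eq(6) by (rule fps_le_trans[OF bound[OF f0] R2])
    qed
  qed
  ultimately show ?thesis
    using that by blast
qed

text \<open>Only the indices 0 and 1 exist, so the further shifts come from the series 1/(1 -
  q^(y+2)), which is both the cofactor of the first gap and a factor of the second gap.\<close>

lemma gap_shifts_1:
  assumes y: "y = 2 * k + 1" "k > 0"
  obtains R where "fps_gap (1 - fps_X ^ 2) (\<Prod>j<2*1. race_factor (y + 1) 1 1 j)
                     (\<Prod>j<2*1. race_factor (y + 1) 1 y j) R"
    "\<And>s. s \<in> {0, y + 1, y + 2, 2 * y + 1, 2 * y + 3, 2 * y + 4, 3 * y + 5} \<Longrightarrow>
        fps_X ^ (1 + s) * even_powers k \<preceq> R"
proof -
  let ?N = "even_powers k"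
  let ?C = "inverse (1 - fps_X ^ (y + 2)) :: rat fps" and ?W = "inverse (1 - fps_X ^ (2 * y + 1)) :: rat fps"
  let ?f = "race_factor (y + 1) 1 1" and ?g = "race_factor (y + 1) 1 y"
  let ?r1 = "fps_X ^ (y + 2) * ?N * (?C * ?W)"
  obtain r0 where r0: "fps_gap (1 - fps_X ^ 2) (?f 0) (?g 0) r0" "fps_X ^ 1 * ?N \<preceq> r0"
    using race_factor_gap[where j = 0 and k = k] unfolding y by (metis add_0_right mult_0_right)
  obtain r1 where r1: "fps_gap (1 - fps_X ^ 2) (?f 1) (?g 1) r1"
    "r1 = fps_X ^ (1 + (y + 1) * 1) * ?N *
       (inverse (1 - fps_X ^ (1 + (y + 1) * 1)) * inverse (1 - fps_X ^ (2 * k + 1 + (y + 1) * 1)))"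
    using race_factor_gap[where j = 1 and k = k and L = 1] unfolding y by (metis order_refl)
  have "1 + (y + 1) * 1 = y + 2" "2 * k + 1 + (y + 1) * 1 = 2 * y + 1"
    using y by auto
  with r1 have r1: "fps_gap (1 - fps_X ^ 2) (?f 1) (?g 1) ?r1"
    by (simp only:)
  let ?R = "r0 * ?f 1 + ?g 0 * ?r1"
  have "{..<2*1} = {0, 1::nat}"
    by auto
  then have "fps_gap (1 - fps_X ^ 2) (\<Prod>j<2*1. ?f j) (\<Prod>j<2*1. ?g j) ?R"
    using fps_gap_mult[OF r0(1) r1] by simp
  moreover have "fps_X ^ (1 + s) * ?N \<preceq> ?R"
    if "s \<in> {0, y + 1, y + 2, 2 * y + 1, 2 * y + 3, 2 * y + 4, 3 * y + 5}" for s
  proof -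
    have C: "fps_X ^ ((y + 2) * i) \<preceq> ?C" and W: "1 \<preceq> ?W" for i
      by (intro X_power_le_inverse one_le_inverse_one_minus_X_power; simp)+
    \<comment> \<open>For L = 1, index 0 belongs to the numerator and index 1 to the denominator of
      \<phi>.\<close>
    have f1: "?f 1 = ?C" and g0: "?g 0 = 1 + fps_X ^ y"
      by (simp_all add: race_factor_def)
    have nn: "0 \<preceq> ?C" "0 \<preceq> ?W" "0 \<preceq> ?g 0" "0 \<preceq> ?N" "0 \<preceq> r0" "0 \<preceq> ?r1"
      using r0 r1 C[of 0] W fps_one_le_imp_nonneg even_powers_nonneg by (auto simp: fps_gap_def)
    have low: "fps_X ^ (1 + (y + 2) * i) * ?N \<preceq> ?R" for i
    proof -
      have "fps_X ^ 1 * ?N * fps_X ^ ((y + 2) * i) \<preceq> r0 * ?C"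
        by (intro fps_le_mult r0 C fps_nonneg_mult nn fps_nonneg_X_power)
      also have "\<dots> \<preceq> ?R"
        unfolding f1 by (intro fps_le_add_right fps_nonneg_mult nn)
      finally show ?thesis
        by (simp only: power_add mult_ac)
    qed
    have high: "fps_X ^ (a + (y + 2) * (i + 1)) * ?N \<preceq> ?R" if "fps_X ^ a \<preceq> ?g 0" for a i
    proof -
      have "fps_X ^ a * (fps_X ^ (y + 2) * ?N * (fps_X ^ ((y + 2) * i) * 1)) \<preceq> ?g 0 * ?r1"
        by (intro fps_le_mult that C W fps_le_refl fps_nonneg_mult nn fps_nonneg_X_power fps_nonneg_one)
      also have "\<dots> \<preceq> ?g 0 * ?r1 + r0 * ?f 1"
        unfolding f1 by (intro fps_le_add_right fps_nonneg_mult nn)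
      finally show ?thesis
        by (simp add: power_add distrib_left mult_ac add.commute)
    qed
    have g: "fps_X ^ 0 \<preceq> ?g 0" "fps_X ^ y \<preceq> ?g 0"
      unfolding g0 by (auto simp: fps_le_def)
    \<comment> \<open>Exponents of the form 1 + (y + 2) i come from \<open>low\<close>, those of the
      form a + (y + 2)(i + 1) with a = 0 or a = y from \<open>high\<close>.\<close>
    from that consider "1 + s = 1 + (y + 2) * 0" | "1 + s = 0 + (y + 2) * (0 + 1)"
      | "1 + s = 1 + (y + 2) * 1" | "1 + s = y + (y + 2) * (0 + 1)"
      | "1 + s = 0 + (y + 2) * (1 + 1)" | "1 + s = 1 + (y + 2) * 2"
      | "1 + s = 0 + (y + 2) * (2 + 1)"
      by auto
    then show ?thesis
      by cases (metis low high g)+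
  qed
  ultimately show ?thesis
    using that by blast
qed

text \<open>The shifts are those available both for $L = 1$ and for $L \ge 2$.\<close>

lemma shift_decomposition:
  fixes n y k :: nat
  assumes y: "y = 2 * k + 1" "k > 0"
    and n: "odd n \<or> n \<ge> y + 3" and res: "n mod (2 * y) \<noteq> y"
  obtains l i s where "n = 2 * y * l + (1 + 2 * i) + s" "i < k"
    "s \<in> {0, y + 1, y + 2, 2 * y + 1, 2 * y + 3}"
proof -
  define \<rho> where "\<rho> = n mod (2 * y)"
  define l where "l = n div (2 * y)"
  have n_eq: "n = 2 * y * l + \<rho>"
    unfolding \<rho>_def l_def by (simp only: mult_div_mod_eq)
  have \<rho>: "\<rho> < 2 * y" "\<rho> \<noteq> y"
    using y res unfolding \<rho>_def by auto
  show ?thesis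
  proof (cases "odd \<rho>")
    case True
    then obtain j where j: "\<rho> = 2 * j + 1"
      by (elim oddE)
    show ?thesis
    proof (cases "j < k")
      case True
      then show ?thesis
        using that[of l j 0] n_eq j by simp
    next
      case False
      then show ?thesis
        using that[of l "j - k - 1" "y + 1"] n_eq j y \<rho> by simp
    qed
  next
    case False
    then obtain j where j: "\<rho> = 2 * j"
      by (auto elim: evenE)
    \<comment> \<open>The odd shifts are at least y + 2, so the smallest even value of 1 + 2i + s is
      y + 3. A smaller even residue must borrow one period 2y.\<close>
    have l: "l > 0" if "\<rho> < y + 3"
    proof (rule ccontr)
      assume "\<not> l > 0"
      then show False
        using n n_eq that False by simp
    qed
    have n_eq': "n = 2 * y * (l - 1) + (2 * y + \<rho>)" if "l > 0"
      using that n_eq by (cases l) auto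
    consider "j = 0" | "0 < j" "j \<le> k" | "j = k + 1" | "j \<ge> k + 2"
      by linarith
    then show ?thesis
    proof cases
      case 1
      then show ?thesis
        using that[of "l - 1" "k - 1" "y + 2"] n_eq' l j y by simp
    next
      case 2
      then show ?thesis
        using that[of "l - 1" "j - 1" "2 * y + 1"] n_eq' l j y by simp
    next
      case 3
      then show ?thesis
        using that[of "l - 1" "k - 1" "2 * y + 3"] n_eq' l j y by simp
    next
      case 4
      then show ?thesis
        using that[of l "j - k - 2" "y + 2"] n_eq j y \<rho> by simp
    qed
  qed
qed

section \<open>Signs of the coefficients for x = y + 2\<close>

lemma gen_a_nonneg:
  assumes "L > 0" and y: "y = 2 * k + 1" "k > 0"
  shows "0 \<preceq> gen_a L y (y + 2)"
proof -
  have "\<forall>j. \<exists>r. fps_gap (1 - fps_X ^ 2) (race_factor (y + 1) L 1 j) (race_factor (y + 1) L y j) r"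
    unfolding y using race_factor_gap by metis
  then obtain R where R: "fps_gap (1 - fps_X ^ 2) (\<Prod>j<2*L. race_factor (y + 1) L 1 j)
                (\<Prod>j<2*L. race_factor (y + 1) L y j) R"
    using fps_gap_prod[of "{..<2*L}"] by metis
  obtain E where "1 \<preceq> E" "gen_a L y (y + 2) = R * inverse (1 - fps_X ^ (2 * y)) * E"
    using gen_a_eq_gap[OF assms(1) y(1) R] .
  moreover have "0 \<preceq> (inverse (1 - fps_X ^ (2 * y)) :: rat fps)"
    using y by (intro fps_one_le_imp_nonneg one_le_inverse_one_minus_X_power) auto
  ultimately show ?thesis
    using R by (auto simp: fps_gap_def intro!: fps_nonneg_mult intro: fps_one_le_imp_nonneg)
qed

text \<open>The residue y modulo 2y is not covered by the common shifts. It needs the shift 2y + 2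
  when L \<ge> 2, and 2y + 4 or 3y + 5 when L = 1.\<close>

lemma gen_a_pos:
  assumes L: "L > 0" and y: "y = 2 * k + 1" "k > 0"
    and n: "odd n \<and> n \<noteq> y \<or> n \<ge> y + 3" and exc: "(L, y, n) \<noteq> (1, 3, 9)"
  shows "0 < fps_nth (gen_a L y (y + 2)) n"
proof (cases "n mod (2 * y) = y")
  case False
  obtain l i s where d: "n = 2 * y * l + (1 + 2 * i) + s" "i < k"
    "s \<in> {0, y + 1, y + 2, 2 * y + 1, 2 * y + 3}"
    using shift_decomposition[OF y _ False] n by blast
  obtain R where "fps_gap (1 - fps_X ^ 2) (\<Prod>j<2*L. race_factor (y + 1) L 1 j)
                (\<Prod>j<2*L. race_factor (y + 1) L y j) R" "fps_X ^ (1 + s) * even_powers k \<preceq> R"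
  proof (cases "L = 1")
    case True
    show ?thesis
      unfolding True by (rule gap_shifts_1[OF y]) (use d that True in auto)
  next
    case False
    with L have "L \<ge> 2"
      by simp
    then show ?thesis
      by (rule gap_shifts[OF _ y(1)]) (use d that in auto)
  qed
  then show ?thesis
    unfolding d(1) using gen_a_nth_pos[OF L y] d(2) by blast
next
  case True
  define l where "l = n div (2 * y)"
  have n_eq: "n = 2 * y * l + y"
    using True div_mult_mod_eq[of n "2 * y"] by (simp add: l_def mult.commute)
  \<comment> \<open>l = 0 would mean n = y, which the hypothesis on \<open>n\<close>
    excludes.\<close>
  with n have "l \<noteq> 0"
    by (intro notI) auto
  then have n_eq': "n = 2 * y * (l - 1) + 3 * y"
    using n_eq by (cases l) auto
  show ?thesis
  proof (cases "L = 1")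
    case False
    with L have "L \<ge> 2"
      by simp
    then obtain R where R: "fps_gap (1 - fps_X ^ 2) (\<Prod>j<2*L. race_factor (y + 1) L 1 j)
        (\<Prod>j<2*L. race_factor (y + 1) L y j) R"
        "\<And>s. s \<in> {0, y + 1, y + 2, 2 * y + 1, 2 * y + 2, 2 * y + 3} \<Longrightarrow>
          fps_X ^ (1 + s) * even_powers k \<preceq> R"
      using gap_shifts[OF _ y(1)] by blast
    have "0 < fps_nth (gen_a L y (y + 2)) (2 * y * (l - 1) + (1 + 2 * (k - 1)) + (2 * y + 2))"
      using y(2) by (intro gen_a_nth_pos[OF L y R]) auto
    also have "2 * y * (l - 1) + (1 + 2 * (k - 1)) + (2 * y + 2) = n"
      unfolding n_eq' using y by simp
    finally show ?thesis .
  next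
    case True
    obtain R where R: "fps_gap (1 - fps_X ^ 2) (\<Prod>j<2*L. race_factor (y + 1) L 1 j)
        (\<Prod>j<2*L. race_factor (y + 1) L y j) R"
        "\<And>s. s \<in> {0, y + 1, y + 2, 2 * y + 1, 2 * y + 3, 2 * y + 4, 3 * y + 5} \<Longrightarrow>
          fps_X ^ (1 + s) * even_powers k \<preceq> R"
      unfolding True using gap_shifts_1[OF y] by blast
    show ?thesis
    proof (cases "k = 1")
      case False
      \<comment> \<open>Here 3y = (2k - 3) + (2y + 4), where 2k - 3 is a positive odd number only
        for k \<ge> 2.\<close>
      then have "0 < fps_nth (gen_a L y (y + 2)) (2 * y * (l - 1) + (1 + 2 * (k - 2)) + (2 * y + 4))"
        using y(2) False by (intro gen_a_nth_pos[OF L y R]) auto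
      also have "2 * y * (l - 1) + (1 + 2 * (k - 2)) + (2 * y + 4) = n"
        unfolding n_eq' using y False by simp
      finally show ?thesis .
    next
      case k: True
      \<comment> \<open>Now y = 3, and l = 1 would be the excluded n = 9. The next candidate is 15 =
        1 + (3y + 5).\<close>
      then have "l - 1 \<noteq> 0"
        using exc True n_eq' y by (intro notI) auto
      then have n15: "2 * y * (l - 2) + (1 + 2 * 0) + (3 * y + 5) = n"
        unfolding n_eq' using k y by simp
      have "0 < fps_nth (gen_a L y (y + 2)) (2 * y * (l - 2) + (1 + 2 * 0) + (3 * y + 5))"
        using y(2) by (intro gen_a_nth_pos[OF L y R]) auto
      then show ?thesis
        unfolding n15 .
    qed
  qed
qed

subsection \<open>Decreasing x\<close>

text \<open>Replacing y + 2 by x creates a gap divisible by 1 - q, which cancels the first factor of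
  \<open>qpoch 1\<close>. The gap of index 0 contains q^x + ... + q^(y+1) times 1/(1 - q^(y+2)),
  hence the positive coefficients claimed.\<close>

lemma gen_a_excess:
  assumes L: "L > 0" and x: "0 < x" "x \<le> y + 2" and y: "y > 0"
  obtains E where "gen_a L y x = gen_a L y (y + 2) + E" "0 \<preceq> E"
    "\<And>n i. x \<le> n \<Longrightarrow> n < y + 2 \<Longrightarrow> 0 < fps_nth E (n + (y + 2) * i)"
proof -
  let ?m = "2 * y + 2" and ?S = "(\<Sum>i<y + 2 - x. fps_X ^ i) :: rat fps"
  let ?a = "\<lambda>j. inverse (1 - fps_X ^ (x + ?m * j)) :: rat fps"
  let ?b = "\<lambda>j. inverse (1 - fps_X ^ (y + 2 + ?m * j)) :: rat fps"
  let ?r = "\<lambda>j. fps_X ^ (x + ?m * j) * ?S * (?a j * ?b j)"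
  have S: "0 \<preceq> ?S"
    by (intro fps_nonneg_sum) simp
  have gap: "fps_gap (1 - fps_X) (?a j) (?b j) (?r j)" for j
  proof (rule fps_gap_inverse)
    have "fps_X ^ (x + ?m * j) - fps_X ^ (y + 2 + ?m * j)
        = (fps_X ^ (x + ?m * j) * (1 - fps_X ^ (y + 2 - x)) :: rat fps)"
      using x by (simp add: right_diff_distrib flip: power_add)
    then show "fps_X ^ (x + ?m * j) - fps_X ^ (y + 2 + ?m * j) = (1 - fps_X) * (fps_X ^ (x + ?m * j) * ?S)"
      by (simp only: one_diff_power_eq mult_ac)
  qed (use x S in \<open>auto intro!: fps_nonneg_mult\<close>)
  obtain R' where R': "fps_gap (1 - fps_X) (\<Prod>j\<in>{1..<L}. ?a j) (\<Prod>j\<in>{1..<L}. ?b j) R'"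
    using fps_gap_prod[of "{1..<L}" "1 - fps_X" ?a ?b ?r] gap by blast
  let ?R = "?r 0 * (\<Prod>j\<in>{1..<L}. ?a j) + ?b 0 * R'"
  have split: "inverse (qpoch c ?m L) =
      inverse (1 - fps_X ^ (c + ?m * 0)) * (\<Prod>j\<in>{1..<L}. inverse (1 - fps_X ^ (c + ?m * j)))"
    for c
    using L by (simp only: qpoch_head fps_inverse_mult inverse_prod_fps mult_0_right add_0_right)
  have R: "fps_gap (1 - fps_X) (inverse (qpoch x ?m L)) (inverse (qpoch (y + 2) ?m L)) ?R"
    unfolding split by (rule fps_gap_mult[OF gap R'])
  let ?T = "(\<Prod>j\<in>{1..<L}. inverse (1 - fps_X ^ (1 + ?m * j))) * inverse (qpoch (2 * y) ?m L)"
  have T: "1 \<preceq> ?T"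
    unfolding qpoch_def using y
    by (intro fps_one_le_mult fps_one_le_prod one_le_inverse_prod one_le_inverse_one_minus_X_power) auto
  have "gen_a L y x - gen_a L y (y + 2)
      = inverse (qpoch 1 ?m L) * inverse (qpoch (2 * y) ?m L) *
        (inverse (qpoch x ?m L) - inverse (qpoch (y + 2) ?m L))"
    unfolding gen_a_def by (simp add: fps_inverse_mult algebra_simps)
  also have "\<dots> = ((1 - fps_X ^ 1) * inverse (1 - fps_X ^ 1)) * (?R * ?T)"
    using R unfolding fps_gap_def split[of 1] by (simp add: mult_ac)
  also have "\<dots> = ?R * ?T"
    by (subst one_minus_X_power_inverse) simp_all
  finally have eq: "gen_a L y x = gen_a L y (y + 2) + ?R * ?T"
    by (simp add: algebra_simps)
  have nn: "0 \<preceq> ?R" "0 \<preceq> ?r 0" "0 \<preceq> ?b 0 * R'"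
    using R R' gap[of 0] by (auto simp: fps_gap_def intro!: fps_nonneg_mult dest: fps_one_le_imp_nonneg)
  have "0 < fps_nth (?R * ?T) (n + (y + 2) * i)" if n: "x \<le> n" "n < y + 2" for n i
  proof -
    have S_pos: "0 < fps_nth ?S (n - x)"
      using n by (simp add: fps_sum_nth sum.delta)
    have b_pos: "0 < fps_nth (?b 0) ((y + 2) * i)"
      using inverse_one_minus_X_power_nth[of "y + 2" "(y + 2) * i", where 'a = rat]
      by (simp only: mult_0_right add_0_right dvd_triv_left) simp
    have a: "1 \<preceq> ?a 0" and b: "0 \<preceq> ?b 0"
      using gap[of 0] fps_one_le_imp_nonneg by (auto simp: fps_gap_def)
    \<comment> \<open>The exponent is split along the factors: x from the power, n - x from
      \<open>?S\<close>, 0 from \<open>?a 0\<close> and (y + 2) i from \<open>?b 0\<close>.\<close>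
    have "0 < fps_nth (fps_X ^ (x + ?m * 0) * ?S * (?a 0 * ?b 0)) (x + (n - x) + (0 + (y + 2) * i))"
      using a b S S_pos b_pos fps_one_le_imp_nonneg[OF a] fps_nth_pos_mono[OF a, of 0]
      by (intro fps_nth_mult_pos fps_nonneg_mult fps_nonneg_X_power) auto
    then have "0 < fps_nth (?r 0) (n + (y + 2) * i)"
      using n by simp
    moreover have "?r 0 \<preceq> ?R * ?T"
    proof -
      have "?r 0 \<preceq> ?r 0 * (\<Prod>j\<in>{1..<L}. ?a j)"
        using R' by (intro fps_le_mult_left nn) (simp add: fps_gap_def)
      also have "\<dots> \<preceq> ?R"
        by (intro fps_le_add_right nn)
      also have "\<dots> \<preceq> ?R * ?T"
        by (intro fps_le_mult_left nn T)
      finally show ?thesis .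
    qed
    ultimately show ?thesis
      using fps_nth_pos_mono by blast
  qed
  moreover have "0 \<preceq> ?R * ?T"
    by (intro fps_nonneg_mult nn fps_one_le_imp_nonneg[OF T])
  ultimately show ?thesis
    using that[OF eq] by blast
qed

subsection \<open>Vanishing coefficients\<close>

text \<open>Congruence modulo q^b: factors with exponents at least \<open>b\<close> may be replaced
  by 1.\<close>

definition fps_agree :: "nat \<Rightarrow> 'a::comm_semiring_1 fps \<Rightarrow> 'a fps \<Rightarrow> bool" where
  "fps_agree b f g \<longleftrightarrow> (\<forall>i<b. fps_nth f i = fps_nth g i)"

lemma fps_agree_refl: "fps_agree b f f"
  by (simp add: fps_agree_def)

lemma fps_agree_mult: "fps_agree b f f' \<Longrightarrow> fps_agree b g g' \<Longrightarrow> fps_agree b (f * g) (f' * g')"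
  unfolding fps_agree_def by (auto simp: fps_mult_nth intro!: sum.cong)

lemma fps_agree_prod_1: "(\<And>i. i \<in> I \<Longrightarrow> fps_agree b (f i) 1) \<Longrightarrow> fps_agree b (\<Prod>i\<in>I. f i) 1"
proof (induction I rule: infinite_finite_induct)
  case (insert i I)
  then show ?case
    using fps_agree_mult[of b "f i" 1 "prod f I" 1] by simp
qed (auto simp: fps_agree_refl)

lemma inverse_agree_1:
  "b \<le> k \<Longrightarrow> 0 < k \<Longrightarrow> fps_agree b (inverse (1 - fps_X ^ k :: 'a::linordered_field fps)) 1"
  by (auto simp: fps_agree_def inverse_one_minus_X_power_nth dest: dvd_imp_le)

lemma inverse_qpoch_agree_1: "b \<le> c \<Longrightarrow> 0 < c \<Longrightarrow> fps_agree b (inverse (qpoch c d L)) 1"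
  unfolding qpoch_def inverse_prod_fps by (intro fps_agree_prod_1 inverse_agree_1) auto

lemma inverse_qpoch_agree:
  assumes "L > 0" "b \<le> c + d" "0 < c"
  shows "fps_agree b (inverse (qpoch c d L)) (inverse (1 - fps_X ^ c))"
proof -
  have "fps_agree b (inverse (1 - fps_X ^ c) * (\<Prod>j\<in>{1..<L}. inverse (1 - fps_X ^ (c + d * j))))
      (inverse (1 - fps_X ^ c :: rat fps) * 1)"
  proof (intro fps_agree_mult fps_agree_refl fps_agree_prod_1 inverse_agree_1)
    fix j assume "j \<in> {1..<L}"
    then have "d * 1 \<le> d * j"
      by (intro mult_le_mono2) auto
    with assms show "b \<le> c + d * j"
      by linarith
  qed (use assms in auto)
  then show ?thesis
    using assms by (simp add: qpoch_head fps_inverse_mult inverse_prod_fps)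
qed

text \<open>Up to q^n the first term is 1/(1 - q), with coefficient 1. The second is 1/((1 - q^2)(1
  - q^y)), whose coefficient counts the solutions of n = 2a + yb. Since n < 2y and y is odd, there
  is just one: b = 0 for even n, a = 0 for n = y.\<close>

lemma gen_a_nth_eq_0:
  assumes L: "L > 0" and y: "odd y" "y > 1" and x: "x \<le> y + 2"
    and n: "n < x" "even n \<or> n = y"
  shows "fps_nth (gen_a L y x) n = 0"
proof -
  \<comment> \<open>Agreement is strict below the bound, so \<open>Suc n\<close> is what includes
    the coefficient of q^n.\<close>
  let ?m = "2 * y + 2" and ?b = "Suc n"
  have "fps_agree ?b (inverse (qpoch 1 ?m L) * inverse (qpoch x ?m L) * inverse (qpoch (2 * y) ?m L))
      (inverse (1 - fps_X ^ 1) * 1 * 1)"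
    using n x y L
    by (intro fps_agree_mult inverse_qpoch_agree_1 inverse_qpoch_agree) auto
  then have A: "fps_nth (inverse (qpoch 1 ?m L * qpoch x ?m L * qpoch (2 * y) ?m L)) n = 1"
    using inverse_one_minus_X_power_nth[of 1 n, where 'a = rat]
    by (simp add: fps_agree_def fps_inverse_mult)
  have "fps_agree ?b (inverse (qpoch 2 ?m L) * inverse (qpoch y ?m L) * inverse (qpoch (2 * y + 1) ?m L))
      (inverse (1 - fps_X ^ 2) * inverse (1 - fps_X ^ y) * 1)"
    using n x y L
    by (intro fps_agree_mult inverse_qpoch_agree_1 inverse_qpoch_agree) auto
  then have "fps_nth (inverse (qpoch 2 ?m L * qpoch y ?m L * qpoch (2 * y + 1) ?m L)) n
      = fps_nth (inverse (1 - fps_X ^ 2) * inverse (1 - fps_X ^ y)) n"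
    by (simp add: fps_agree_def fps_inverse_mult)
  also have "\<dots> = (\<Sum>i=0..n. if i = (if even n then n else 0) then 1 else 0)"
    unfolding fps_mult_nth
  proof (intro sum.cong refl)
    fix i assume "i \<in> {0..n}"
    then have i: "i \<le> n"
      by simp
    have "y dvd n - i \<longleftrightarrow> n - i = 0 \<or> n - i = y"
    proof
      assume "y dvd n - i"
      then obtain c where c: "n - i = y * c" ..
      \<comment> \<open>n < x \<le> y + 2 and y > 1 give n < 2y.\<close>
      have "c < 2"
      proof (rule ccontr)
        assume "\<not> c < 2"
        then have "y * 2 \<le> y * c"
          by (intro mult_le_mono2) simp
        then show False
          using c n x y by linarith
      qed
      then have "c = 0 \<or> c = 1"
        by linarith
      then show "n - i = 0 \<or> n - i = y"
        using c by auto
    qed auto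
    moreover have "even i \<and> (n - i = 0 \<or> n - i = y) \<longleftrightarrow> i = (if even n then n else 0)"
    proof (cases "even n")
      case True
      have "i = n" if "n - i = y" "even i"
      proof -
        have "n = i + y"
          using that i y by simp
        then show ?thesis
          using that True y(1) by simp
      qed
      then show ?thesis
        using True i by auto
    next
      case False
      then have "n = y"
        using n by simp
      then show ?thesis
        using False i by (cases "n - i = y") auto
    qed
    ultimately have iff: "even i \<and> y dvd n - i \<longleftrightarrow> i = (if even n then n else 0)"
      by (simp only:)
    have "fps_nth (inverse (1 - fps_X ^ 2)) i * fps_nth (inverse (1 - fps_X ^ y)) (n - i)
        = (if even i \<and> y dvd n - i then 1 else (0 :: rat))"
      using y by (simp add: inverse_one_minus_X_power_nth)
    then show "fps_nth (inverse (1 - fps_X ^ 2)) i * fps_nth (inverse (1 - fps_X ^ y)) (n - i)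
        = (if i = (if even n then n else 0) then 1 else (0 :: rat))"
      unfolding iff .
  qed
  also have "\<dots> = 1"
    by (simp add: sum.delta)
  finally show ?thesis
    using A by (simp add: gen_a_def)
qed

text \<open>Both coefficients are 3: with parts 1, 5, 6 at most one part of 9 exceeds 1, and with
  parts 2, 3, 7 there are 3+3+3, 3+2+2+2 and 7+2.\<close>

lemma gen_a_nth_1_3_9_5: "fps_nth (gen_a 1 3 5) 9 = 0"
proof -
  have "gen_a 1 3 5 = inverse (1 - fps_X ^ 1) * (inverse (1 - fps_X ^ 5) * inverse (1 - fps_X ^ 6))
      - inverse (1 - fps_X ^ 2) * (inverse (1 - fps_X ^ 3) * inverse (1 - fps_X ^ 7))"
    by (simp add: gen_a_def qpoch_def fps_inverse_mult mult_ac)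
  then have "fps_nth (gen_a 1 3 5) 9 =
      (\<Sum>i=0..9::nat. (if 1 dvd i then 1 else 0) *
        (\<Sum>j=0..9 - i. (if 5 dvd j then 1 else 0) * (if 6 dvd 9 - i - j then 1 else 0)))
    - (\<Sum>i=0..9::nat. (if 2 dvd i then 1 else 0) *
        (\<Sum>j=0..9 - i. (if 3 dvd j then 1 else 0) * (if 7 dvd 9 - i - j then 1 else 0)))"
    by (simp only: fps_sub_nth fps_mult_nth inverse_one_minus_X_power_nth zero_less_numeral zero_less_one)
  also have "\<dots> = 0"
    by code_simp
  finally show ?thesis .
qed

section \<open>Combination of the two contributions\<close>

theorem theorem4:
  fixes L y x :: nat
  assumes "L > 0" and "odd y" and "y > 1" and "1 < x" and "x \<le> y + 2"
  shows "(\<forall>n\<ge>1. a_coeff L y n x \<ge> 0) \<and>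
         (\<forall>n\<ge>1. a_coeff L y n x = 0 \<longleftrightarrow>
             ((n < x \<and> even n) \<or> (n = y \<and> y < x) \<or> (L, y, n, x) = (1, 3, 9, 5)))"
proof -
  obtain k where y: "y = 2 * k + 1" "k > 0"
    using assms(2,3) by (elim oddE) auto
  obtain E where E: "gen_a L y x = gen_a L y (y + 2) + E" "0 \<preceq> E"
      "\<And>n i. x \<le> n \<Longrightarrow> n < y + 2 \<Longrightarrow> 0 < fps_nth E (n + (y + 2) * i)"
    using gen_a_excess[of L x y] assms by auto
  have nonneg: "0 \<le> fps_nth (gen_a L y (y + 2)) n" "0 \<le> fps_nth E n" for n
    using gen_a_nonneg[OF assms(1) y] E(2) by (simp_all add: fps_le_def)
  have zero: "a_coeff L y n x = 0"
    if "n < x \<and> even n \<or> n = y \<and> y < x \<or> (L, y, n, x) = (1, 3, 9, 5)" for n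
  proof (cases "(L, y, n, x) = (1, 3, 9, 5)")
    case True
    then show ?thesis
      using gen_a_nth_1_3_9_5 by (simp add: a_coeff_def)
  next
    case False
    then show ?thesis
      using that gen_a_nth_eq_0[of L y x n] assms by (auto simp: a_coeff_def)
  qed
  have pos: "0 < a_coeff L y n x"
    if not_zero: "\<not> (n < x \<and> even n \<or> n = y \<and> y < x \<or> (L, y, n, x) = (1, 3, 9, 5))" for n
  proof -
    \<comment> \<open>The series for x = y + 2 settles the first case and the excess
      \<open>E\<close> the second. In the third, the series for x = y + 2 vanishes at n = 9, so
      \<open>E\<close> has to contribute.\<close>
    consider "odd n \<and> n \<noteq> y \<or> n \<ge> y + 3" "(L, y, n) \<noteq> (1, 3, 9)"
      | "x \<le> n" "n < y + 2" | "(L, y, n) = (1, 3, 9)" "x < 5"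
    proof (cases "(L, y, n) = (1, 3, 9)")
      case True
      then have "x \<noteq> 5" "x \<le> 5"
        using assms(5) not_zero by auto
      then show ?thesis
        using True by (intro that(3)) auto
    next
      case False
      show ?thesis
      proof (cases "odd n \<and> n \<noteq> y \<or> n \<ge> y + 3")
        case True
        with False show ?thesis
          by (intro that(1))
      next
        case range: False
        \<comment> \<open>y + 2 is odd and different from y, so it falls under the first case; what
          remains lies below y + 2.\<close>
        have "n \<noteq> y + 2"
          using range assms(2) by auto
        then show ?thesis
          using range not_zero by (intro that(2)) auto
      qed
    qed
    then have "0 < fps_nth (gen_a L y (y + 2)) n \<or> 0 < fps_nth E n"
    proof cases
      case 1
      then show ?thesis
        using gen_a_pos[OF assms(1) y] by blast
    next
      case 2
      then show ?thesis
        using E(3)[of n 0] by simp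
    next
      case 3
      then show ?thesis
        \<comment> \<open>9 = 4 + (y + 2) with y = 3, and x \<le> 4 < y + 2.\<close>
        using E(3)[of 4 1] by simp
    qed
    then show ?thesis
      using nonneg[of n] by (auto simp: a_coeff_def E(1) intro: add_pos_nonneg add_nonneg_pos)
  qed
  show ?thesis
    using zero pos by (metis less_imp_le less_numeral_extra(3) order_refl)
qed

end
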